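(* Let $\Sigma$ be a finite set, let $p\in\Delta(\Sigma)$ have full support, let $m\in\mathbb{N}$, and let $g^{(1)},\dots,g^{(m)}\in\{0,1\}^{\Sigma}$. Set $q^{(0)}:=p$ and consider the chained optimization problems over $q^{(1)},\dots,q^{(m)}\in\Delta(\Sigma)$, for $i=1,\dots,m$, $$q^{(i)}\in\arg\max_{q\in\Delta(\Sigma)}\ \Big(g^{(i)}\cdot q-\frac12\sum_{u\in\Sigma}\frac{(q_u-q^{(i-1)}_u)^2}{q^{(i-1)}_u}\Big).$$ Then the family defined by $q^{(0)}=p$ and $$\forall i\in\{1,\dots,m\},\ \forall u\in\Sigma,\qquad q^{(i)}_u=q^{(i-1)}_u\Big(1+\big(g^{(i)}_u-q^{(i-1)}\cdot g^{(i)}\big)\Big)$$ is an optimal solution (i.e. each $q^{(i)}$ lies in the corresponding argmax).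
   Context: $\Delta(\Sigma)$ is the set of probability vectors $q=(q_u)_{u\in\Sigma}$ on the finite set $\Sigma$; full support means $p_u>0$ for all $u$. The dot product is $g\cdot q=\sum_{u\in\Sigma}g_uq_u$. *)

theory Defs
  imports "HOL-Analysis.Analysis"
begin

definition prob_simplex :: "(real ^ 's) set" where
  "prob_simplex = {q. (\<forall>u. 0 \<le> q $ u) \<and> (\<Sum>u\<in>UNIV. q $ u) = 1}"

text \<open>The quotient is meant for reference vectors \<open>r\<close> with all components positive; at a zero
  component of \<open>r\<close> the summand is \<open>0\<close>, by the convention \<open>x / 0 = 0\<close>.\<close>

definition step_objective :: "real ^ 's \<Rightarrow> real ^ 's \<Rightarrow> real ^ 's \<Rightarrow> real" where
  "step_objective g r q = g \<bullet> q - 1 / 2 * (\<Sum>u\<in>UNIV. (q $ u - r $ u)\<^sup>2 / r $ u)"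

end

(* With c = q^(i-1) . g^(i), the proposed maximiser s satisfies s_u - r_u = r_u (g_u - c)
   (r = q^(i-1)), i.e. the gradient of the objective at s is the constant vector c, which is
   orthogonal to the simplex.  Completing the square, the objective at s exceeds that at x by
   1/2 * sum_u (x_u - s_u)^2 / r_u.  Full support is preserved because g_u = 0 forces c < 1. *)
theory Submission
  imports Defs
begin

text \<open>The relative interior of the simplex. It serves as the invariant along the chain, since
  the next objective divides by the components of the current vector.\<close>

definition pos_simplex :: "(real ^ 's) set" where
  "pos_simplex = {q \<in> prob_simplex. \<forall>u. 0 < q $ u}"

text \<open>Total mass is kept because the deviations \<open>g $ u - r \<bullet> g\<close> have mean
  zero under \<open>r\<close>.\<close>

lemma step_in_pos_simplex:
  fixes g r s :: "real ^ 's"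
  assumes r: "r \<in> pos_simplex"
    and g: "\<And>u. g $ u \<in> {0, 1}"
    and s: "\<And>u. s $ u = r $ u * (1 + (g $ u - r \<bullet> g))"
  shows "s \<in> pos_simplex"
proof -
  have rpos: "0 < r $ u" for u
    using r by (simp add: pos_simplex_def)
  have rsum: "(\<Sum>u\<in>UNIV. r $ u) = 1"
    using r by (simp add: pos_simplex_def prob_simplex_def)
  have rg: "r \<bullet> g = (\<Sum>u\<in>UNIV. r $ u * g $ u)"
    by (simp add: inner_vec_def)
  \<comment> \<open>This is the mass that \<open>r\<close> gives to the zeros of \<open>g\<close>,
    so it is at least \<open>r $ u\<close> at each such zero.\<close>
  have slack: "1 - r \<bullet> g = (\<Sum>u\<in>UNIV. r $ u * (1 - g $ u))"
    by (simp add: rg rsum right_diff_distrib sum_subtractf)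
  have nonneg: "0 \<le> r $ u * (1 - g $ u)" for u
    using rpos[of u] g[of u] by auto
  have spos: "0 < s $ u" for u
  proof -
    have "r $ u * (1 - g $ u) \<le> 1 - r \<bullet> g"
      unfolding slack by (rule member_le_sum) (use nonneg in auto)
    \<comment> \<open>If \<open>g $ u = 0\<close>, the factor is at least \<open>r $ u\<close>; if
      \<open>g $ u = 1\<close>, it is at least 1.\<close>
    then have "0 < 1 + (g $ u - r \<bullet> g)"
      using rpos[of u] g[of u] by auto
    then show ?thesis
      using rpos[of u] by (simp add: s)
  qed
  have "(\<Sum>u\<in>UNIV. s $ u) =
      (\<Sum>u\<in>UNIV. r $ u) + (\<Sum>u\<in>UNIV. r $ u * g $ u) - (\<Sum>u\<in>UNIV. r $ u) * (r \<bullet> g)"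
    by (simp add: s algebra_simps sum.distrib sum_subtractf sum_distrib_left)
  then have "(\<Sum>u\<in>UNIV. s $ u) = 1"
    by (simp add: rsum rg)
  then show ?thesis
    using spos by (simp add: pos_simplex_def prob_simplex_def less_imp_le)
qed

text \<open>Exact second-order expansion at \<open>s\<close>: the gradient there is constantly
  \<open>c\<close>, so the linear term is \<open>c\<close> times a difference of total masses, which
  vanishes by \<open>eq\<close>.\<close>

lemma step_objective_gap:
  fixes g r s x :: "real ^ 's"
  assumes rpos: "\<And>u. 0 < r $ u"
    and s: "\<And>u. s $ u = r $ u * (1 + (g $ u - c))"
    and eq: "(\<Sum>u\<in>UNIV. x $ u) = (\<Sum>u\<in>UNIV. s $ u)"
  shows "step_objective g r s - step_objective g r x =
    1 / 2 * (\<Sum>u\<in>UNIV. (x $ u - s $ u)\<^sup>2 / r $ u)"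
proof -
  have pt: "g $ u * s $ u - 1 / 2 * ((s $ u - r $ u)\<^sup>2 / r $ u)
      - (g $ u * x $ u - 1 / 2 * ((x $ u - r $ u)\<^sup>2 / r $ u))
      = 1 / 2 * ((x $ u - s $ u)\<^sup>2 / r $ u) + c * (s $ u - x $ u)" for u
  proof -
    \<comment> \<open>Eliminating \<open>g\<close> turns the claim into a rational identity in
      \<open>s\<close>, \<open>r\<close>, \<open>x\<close> and \<open>c\<close>.\<close>
    have g: "g $ u = s $ u / r $ u - 1 + c"
      using rpos[of u] by (simp add: s)
    show ?thesis
      unfolding g using rpos[of u] by (simp add: field_simps power2_eq_square)
  qed
  have "step_objective g r s - step_objective g r x =
      (\<Sum>u\<in>UNIV. g $ u * s $ u - 1 / 2 * ((s $ u - r $ u)\<^sup>2 / r $ u)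
      - (g $ u * x $ u - 1 / 2 * ((x $ u - r $ u)\<^sup>2 / r $ u)))"
    unfolding step_objective_def inner_vec_def inner_real_def sum_subtractf sum_distrib_left ..
  also have "\<dots> = 1 / 2 * (\<Sum>u\<in>UNIV. (x $ u - s $ u)\<^sup>2 / r $ u)
      + c * ((\<Sum>u\<in>UNIV. s $ u) - (\<Sum>u\<in>UNIV. x $ u))"
    unfolding pt sum.distrib sum_subtractf[symmetric] sum_distrib_left ..
  finally show ?thesis
    by (simp add: eq)
qed

lemma step_is_arg_max:
  fixes g r s :: "real ^ 's"
  assumes r: "r \<in> pos_simplex"
    and s: "\<And>u. s $ u = r $ u * (1 + (g $ u - c))"
    and mem: "s \<in> prob_simplex"
  shows "is_arg_max (step_objective g r) (\<lambda>x. x \<in> prob_simplex) s"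
proof -
  have rpos: "0 < r $ u" for u
    using r by (simp add: pos_simplex_def)
  have "step_objective g r x \<le> step_objective g r s" if "x \<in> prob_simplex" for x
  proof -
    have "(\<Sum>u\<in>UNIV. x $ u) = (\<Sum>u\<in>UNIV. s $ u)"
      using that mem by (simp add: prob_simplex_def)
    from step_objective_gap[OF rpos s this]
    have "step_objective g r s - step_objective g r x =
      1 / 2 * (\<Sum>u\<in>UNIV. (x $ u - s $ u)\<^sup>2 / r $ u)" .
    moreover have "0 \<le> (\<Sum>u\<in>UNIV. (x $ u - s $ u)\<^sup>2 / r $ u)"
      using rpos by (intro sum_nonneg divide_nonneg_pos) auto
    ultimately show ?thesis
      by linarith
  qed
  then show ?thesis
    using mem by (auto simp: is_arg_max_linorder)
qed

theorem theoremD8: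
  fixes p :: "real ^ 's"
    and m :: nat
    and g q :: "nat \<Rightarrow> real ^ 's"
  assumes "p \<in> prob_simplex"
    and "\<forall>u. 0 < p $ u"
    and "\<forall>i\<in>{1..m}. \<forall>u. g i $ u \<in> {0, 1}"
    and "q 0 = p"
    and "\<forall>i\<in>{1..m}. \<forall>u. q i $ u = q (i - 1) $ u * (1 + (g i $ u - q (i - 1) \<bullet> g i))"
  shows "\<forall>i\<in>{1..m}. is_arg_max (step_objective (g i) (q (i - 1))) (\<lambda>x. x \<in> prob_simplex) (q i)"
proof -
  \<comment> \<open>The bound on \<open>i\<close> is kept in the induction because the recursion is
    only given up to \<open>m\<close>.\<close>
  have pos: "q i \<in> pos_simplex" if "i \<le> m" for i
    using that
  proof (induction i)
    case 0
    then show ?case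
      using assms by (simp add: pos_simplex_def)
  next
    case (Suc i)
    then have i: "Suc i \<in> {1..m}" "q i \<in> pos_simplex"
      by auto
    show ?case
      by (rule step_in_pos_simplex[OF i(2), of "g (Suc i)"])
        (use assms(3,5) i(1) in \<open>fastforce+\<close>)
  qed
  show ?thesis
  proof
    fix i assume i: "i \<in> {1..m}"
    then have prev: "q (i - 1) \<in> pos_simplex" and mem: "q i \<in> prob_simplex"
      using pos[of "i - 1"] pos[of i] by (auto simp: pos_simplex_def)
    show "is_arg_max (step_objective (g i) (q (i - 1))) (\<lambda>x. x \<in> prob_simplex) (q i)"
      \<comment> \<open>Matching with the recursion sets \<open>c\<close> to
        \<open>q (i - 1) \<bullet> g i\<close>.\<close>
      by (rule step_is_arg_max[OF prev _ mem]) (use assms(5) i in blast)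
  qed
qed

end
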